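(* Let $f(x)=-\frac16\mathcal A x^3$ be the hypergraph matching objective on $\mathbb R^n$, $n=n_1n_2$, and consider the sparse constrained problem $$(P)\quad \min_{x\in\mathbb R^n} f(x)\quad\text{s.t. } e^T\bar x_i=1,\ i=1,\dots,n_1,\quad x\ge 0,\quad \|x\|_0\le n_1,$$ and its relaxation $$(R)\quad \min_{x\in\mathbb R^n} f(x)\quad\text{s.t. } e^T\bar x_i=1,\ i=1,\dots,n_1,\quad x\ge 0.$$ Then there exists a global minimizer $x^*$ of $(R)$ such that $\|x^*\|_0=n_1$. Furthermore, $x^*$ is a global minimizer of $(P)$.
   Context: Let $n_1\le n_2$ be positive integers and $n=n_1n_2$. A vector $x\in\mathbb R^n$ is partitioned into blocks $x=(\bar x_1^T,\dots,\bar x_{n_1}^T)^T$ with $\bar x_i\in\mathbb R^{n_2}$; $e\in\mathbb R^{n_2}$ is the all-ones vector; $\|x\|_0$ is the number of nonzero entries of $x$; inequalities between vectors are entrywise. Hypergraph data: $G_1=(V_1,E_1)$, $G_2=(V_2,E_2)$ are 3-uniform hypergraphs with $V_1=\{1,\dots,n_1\}$, $V_2=\{1,\dots,n_2\}$; every hyperedge is a triple of three distinct points. The score tensor $\mathcal B\in\mathbb R^{n_1\times n_2\times n_1\times n_2\times n_1\times n_2}$ satisfies: $\mathcal B_{l_1l_2j_1j_2k_1k_2}\ge 0$ always; it is $0$ unless $(l_1,j_1,k_1)\in E_1$ and $(l_2,j_2,k_2)\in E_2$; and it is invariant under applying the same permutation to $(l_1,j_1,k_1)$ and to $(l_2,j_2,k_2)$.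 The tensor $\mathcal A\in\mathbb R^{n\times n\times n}$ is $\mathcal A_{ljk}=\mathcal B_{l_1l_2j_1j_2k_1k_2}$ with $l=(l_1-1)n_2+l_2$, $j=(j_1-1)n_2+j_2$, $k=(k_1-1)n_2+k_2$. (Thus $\mathcal A$ is nonnegative, symmetric, and $\mathcal A_{ljk}\ne0$ only if $l,j,k$ lie in three different blocks.) $\mathcal A x^3:=\sum_{l,j,k}\mathcal A_{ljk}x_lx_jx_k$. *)

theory Defs
  imports Complex_Main "HOL-Library.FuncSet" "HOL-Combinatorics.Permutations"
begin

text \<open>Vertices, blocks and coordinates are numbered from 1. The space of real vectors of
  dimension \<open>n\<close> is \<open>{1..n} \<rightarrow>\<^sub>E UNIV\<close>.\<close>

definition rvecs :: "nat \<Rightarrow> (nat \<Rightarrow> real) set" where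
  "rvecs n = {1..n} \<rightarrow>\<^sub>E UNIV"

definition uniform3 :: "'a set \<Rightarrow> 'a set set \<Rightarrow> bool" where
  "uniform3 V E \<longleftrightarrow> (\<forall>e\<in>E. e \<subseteq> V \<and> card e = 3)"

text \<open>The tensor argument order is \<open>l1 l2 j1 j2 k1 k2\<close>. Hyperedges are unordered, so a triple of
  vertices belongs to \<open>E\<close> when the set of its three entries does; this forces them to be distinct.\<close>

definition score_tensor ::
  "nat \<Rightarrow> nat \<Rightarrow> nat set set \<Rightarrow> nat set set \<Rightarrow> (nat \<Rightarrow> nat \<Rightarrow> nat \<Rightarrow> nat \<Rightarrow> nat \<Rightarrow> nat \<Rightarrow> real) \<Rightarrow> bool"
where
  "score_tensor n1 n2 E1 E2 B \<longleftrightarrow>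
     (\<forall>l1\<in>{1..n1}. \<forall>l2\<in>{1..n2}. \<forall>j1\<in>{1..n1}. \<forall>j2\<in>{1..n2}. \<forall>k1\<in>{1..n1}. \<forall>k2\<in>{1..n2}.
        B l1 l2 j1 j2 k1 k2 \<ge> 0 \<and>
        (\<not> ({l1, j1, k1} \<in> E1 \<and> {l2, j2, k2} \<in> E2) \<longrightarrow> B l1 l2 j1 j2 k1 k2 = 0)) \<and>
     (\<forall>p u v. p permutes {1..3::nat} \<longrightarrow> u \<in> {1..3} \<rightarrow> {1..n1} \<longrightarrow> v \<in> {1..3} \<rightarrow> {1..n2} \<longrightarrow>
        B (u (p 1)) (v (p 1)) (u (p 2)) (v (p 2)) (u (p 3)) (v (p 3)) =
        B (u 1) (v 1) (u 2) (v 2) (u 3) (v 3))"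

definition idx :: "nat \<Rightarrow> nat \<Rightarrow> nat \<Rightarrow> nat" where
  "idx n2 i j = (i - 1) * n2 + j"

text \<open>For \<open>l = idx n2 l1 l2\<close> with \<open>l2 \<in> {1..n2}\<close> and \<open>l1 \<ge> 1\<close>, the following two functions
  recover \<open>l1\<close> and \<open>l2\<close>.\<close>

definition blk :: "nat \<Rightarrow> nat \<Rightarrow> nat" where
  "blk n2 l = (l - 1) div n2 + 1"

definition pos :: "nat \<Rightarrow> nat \<Rightarrow> nat" where
  "pos n2 l = (l - 1) mod n2 + 1"

definition flat_tensor ::
  "nat \<Rightarrow> (nat \<Rightarrow> nat \<Rightarrow> nat \<Rightarrow> nat \<Rightarrow> nat \<Rightarrow> nat \<Rightarrow> real) \<Rightarrow> nat \<Rightarrow> nat \<Rightarrow> nat \<Rightarrow> real"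
where
  "flat_tensor n2 B l j k =
     B (blk n2 l) (pos n2 l) (blk n2 j) (pos n2 j) (blk n2 k) (pos n2 k)"

lemma blk_idx: "i \<ge> 1 \<Longrightarrow> j \<in> {1..n2} \<Longrightarrow> blk n2 (idx n2 i j) = i"
  and pos_idx: "i \<ge> 1 \<Longrightarrow> j \<in> {1..n2} \<Longrightarrow> pos n2 (idx n2 i j) = j"
proof -
  assume i: "i \<ge> 1" and j: "j \<in> {1..n2}"
  obtain i' j' where "i = Suc i'" "j = Suc j'" "j' < n2"
    using i j by (cases i; cases j) auto
  then show "blk n2 (idx n2 i j) = i" "pos n2 (idx n2 i j) = j"
    by (simp_all add: blk_def pos_def idx_def)
qed

lemma flat_tensor_idx:
  assumes "l1 \<ge> 1" "j1 \<ge> 1" "k1 \<ge> 1" "l2 \<in> {1..n2}" "j2 \<in> {1..n2}" "k2 \<in> {1..n2}"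
  shows "flat_tensor n2 B (idx n2 l1 l2) (idx n2 j1 j2) (idx n2 k1 k2) = B l1 l2 j1 j2 k1 k2"
  using assms by (simp only: flat_tensor_def blk_idx pos_idx)

definition cubic_form :: "nat \<Rightarrow> (nat \<Rightarrow> nat \<Rightarrow> nat \<Rightarrow> real) \<Rightarrow> (nat \<Rightarrow> real) \<Rightarrow> real" where
  "cubic_form n A x = (\<Sum>l\<in>{1..n}. \<Sum>j\<in>{1..n}. \<Sum>k\<in>{1..n}. A l j k * x l * x j * x k)"

definition objective ::
  "nat \<Rightarrow> nat \<Rightarrow> (nat \<Rightarrow> nat \<Rightarrow> nat \<Rightarrow> nat \<Rightarrow> nat \<Rightarrow> nat \<Rightarrow> real) \<Rightarrow> (nat \<Rightarrow> real) \<Rightarrow> real"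
where
  "objective n1 n2 B x = - (1 / 6) * cubic_form (n1 * n2) (flat_tensor n2 B) x"

definition block :: "nat \<Rightarrow> (nat \<Rightarrow> real) \<Rightarrow> nat \<Rightarrow> nat \<Rightarrow> real" where
  "block n2 x i = (\<lambda>j. x (idx n2 i j))"

definition norm0 :: "nat \<Rightarrow> (nat \<Rightarrow> real) \<Rightarrow> nat" where
  "norm0 n x = card {i \<in> {1..n}. x i \<noteq> 0}"

definition feasible_R :: "nat \<Rightarrow> nat \<Rightarrow> (nat \<Rightarrow> real) set" where
  "feasible_R n1 n2 = {x \<in> rvecs (n1 * n2).
     (\<forall>i\<in>{1..n1}. (\<Sum>j\<in>{1..n2}. block n2 x i j) = 1) \<and> (\<forall>l\<in>{1..n1 * n2}. x l \<ge> 0)}"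

definition feasible_P :: "nat \<Rightarrow> nat \<Rightarrow> (nat \<Rightarrow> real) set" where
  "feasible_P n1 n2 = {x \<in> rvecs (n1 * n2).
     (\<forall>i\<in>{1..n1}. (\<Sum>j\<in>{1..n2}. block n2 x i j) = 1) \<and> (\<forall>l\<in>{1..n1 * n2}. x l \<ge> 0) \<and>
     norm0 (n1 * n2) x \<le> n1}"

end

(* Every monomial with a nonzero coefficient takes its three variables from three different
   blocks, so the cubic form is affine in each single block. A feasible block is a convex
   combination of unit vectors; replacing it by the best of these unit vectors does not decrease
   the form. Doing this block by block moves any feasible point to one whose blocks are all unit
   vectors. There are finitely many of those, and each has exactly n1 nonzero entries. *)
theory Submission
  imports Defs
begin

section \<open>Arithmetic of block and position indices\<close>

lemma idx_in_range: "i \<in> {1..n1} \<Longrightarrow> j \<in> {1..n2} \<Longrightarrow> idx n2 i j \<in> {1..n1 * n2}"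
proof -
  assume i: "i \<in> {1..n1}" and j: "j \<in> {1..n2}"
  have "(i - 1) * n2 + n2 = i * n2"
    using i by (cases i) auto
  also have "\<dots> \<le> n1 * n2"
    using i by simp
  finally show ?thesis
    using j by (simp add: idx_def)
qed

lemma blk_in_range: "l \<in> {1..n1 * n2} \<Longrightarrow> blk n2 l \<in> {1..n1}"
proof -
  assume l: "l \<in> {1..n1 * n2}"
  then have "l - 1 < n1 * n2"
    by auto
  then have "(l - 1) div n2 < n1"
    by (simp add: less_mult_imp_div_less)
  then show ?thesis
    by (simp add: blk_def)
qed

lemma pos_in_range: "1 \<le> n2 \<Longrightarrow> pos n2 l \<in> {1..n2}"
  using mod_less_divisor[of n2 "l - 1"] by (simp add: pos_def Suc_le_eq)

lemma idx_blk_pos: "1 \<le> l \<Longrightarrow> idx n2 (blk n2 l) (pos n2 l) = l"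
  by (simp add: idx_def blk_def pos_def flip: add.assoc)

section \<open>Replacing one block by a unit vector\<close>

definition unit_block :: "nat \<Rightarrow> (nat \<Rightarrow> real) \<Rightarrow> nat \<Rightarrow> bool" where
  "unit_block n2 x i \<longleftrightarrow> (\<exists>s\<in>{1..n2}. \<forall>j\<in>{1..n2}. block n2 x i j = (if j = s then 1 else 0))"

text \<open>The range test keeps the value \<open>undefined\<close> outside the index set, so
  membership in \<open>rvecs\<close> survives. It matters at \<open>l = 0\<close>, where truncated
  subtraction gives \<open>blk n2 0 = 1\<close>.\<close>

definition set_unit_block ::
  "nat \<Rightarrow> nat \<Rightarrow> nat \<Rightarrow> nat \<Rightarrow> (nat \<Rightarrow> real) \<Rightarrow> nat \<Rightarrow> real" where
  "set_unit_block n1 n2 m s x = (\<lambda>l. if l \<in> {1..n1 * n2} \<and> blk n2 l = m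
     then (if pos n2 l = s then 1 else 0) else x l)"

lemma block_set_unit_block:
  assumes "i \<in> {1..n1}" "j \<in> {1..n2}"
  shows "block n2 (set_unit_block n1 n2 m s x) i j =
    (if i = m then (if j = s then 1 else 0) else block n2 x i j)"
proof -
  have "blk n2 (idx n2 i j) = i" "pos n2 (idx n2 i j) = j"
    using assms blk_idx pos_idx by auto
  then show ?thesis
    using idx_in_range[OF assms] by (simp only: block_def set_unit_block_def simp_thms)
qed

lemma unit_block_set_unit_block:
  assumes "i \<in> {1..n1}" "s \<in> {1..n2}" "i = m \<or> unit_block n2 x i"
  shows "unit_block n2 (set_unit_block n1 n2 m s x) i"
proof (cases "i = m")
  case True
  then show ?thesis
    using assms unfolding unit_block_def
    by (intro bexI[of _ s]) (simp_all add: block_set_unit_block del: atLeastAtMost_iff)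
next
  case False
  then show ?thesis
    using assms unfolding unit_block_def
    by (simp add: block_set_unit_block del: atLeastAtMost_iff)
qed

lemma set_unit_block_feasible:
  assumes x: "x \<in> feasible_R n1 n2" and s: "s \<in> {1..n2}"
  shows "set_unit_block n1 n2 m s x \<in> feasible_R n1 n2"
proof -
  let ?y = "set_unit_block n1 n2 m s x"
  have "(\<Sum>j\<in>{1..n2}. block n2 ?y i j) = 1" if i: "i \<in> {1..n1}" for i
  proof -
    have "(\<Sum>j\<in>{1..n2}. block n2 ?y i j) =
      (\<Sum>j\<in>{1..n2}. if i = m then (if j = s then 1 else 0) else block n2 x i j)"
      using i by (intro sum.cong refl block_set_unit_block)
    also have "\<dots> = 1"
      using x i s unfolding feasible_R_def by (cases "i = m") auto
    finally show ?thesis .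
  qed
  moreover have "?y \<in> rvecs (n1 * n2)"
    using x by (auto simp: feasible_R_def rvecs_def set_unit_block_def PiE_def extensional_def)
  moreover have "\<forall>l\<in>{1..n1 * n2}. ?y l \<ge> 0"
    using x by (simp add: feasible_R_def set_unit_block_def)
  ultimately show ?thesis
    by (simp add: feasible_R_def)
qed

section \<open>Affinity of the cubic form in a single block\<close>

lemma sum_block_set_unit_block:
  assumes "l \<in> {1..n1 * n2}" "1 \<le> n2" "blk n2 l = m"
  shows "(\<Sum>s\<in>{1..n2}. block n2 x m s * set_unit_block n1 n2 m s x l) = x l"
proof -
  \<comment> \<open>A block is the combination of the unit vectors weighted by its own entries; at
    coordinate \<open>l\<close> only the unit vector with its 1 at \<open>pos n2 l\<close>
    contributes.\<close>
  have "(\<Sum>s\<in>{1..n2}. block n2 x m s * set_unit_block n1 n2 m s x l) =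
    (\<Sum>s\<in>{1..n2}. if pos n2 l = s then block n2 x m s else 0)"
    using assms by (intro sum.cong) (auto simp: set_unit_block_def)
  also have "\<dots> = block n2 x m (pos n2 l)"
    using pos_in_range[OF assms(2), of l] by simp
  also have "\<dots> = x l"
    using assms idx_blk_pos[of l n2] by (auto simp: block_def)
  finally show ?thesis .
qed

text \<open>At most one of the three coordinates lies in block \<open>m\<close>, so at most one
  factor varies with \<open>s\<close>. Averaging that factor restores its value in \<open>x\<close>,
  while the other two are constants that leave the sum.\<close>

lemma sum_monomial_set_unit_block:
  fixes n1 n2 m :: nat and x :: "nat \<Rightarrow> real"
  defines "r \<equiv> \<lambda>s. set_unit_block n1 n2 m s x"
  assumes range: "a \<in> {1..n1 * n2}" "b \<in> {1..n1 * n2}" "c \<in> {1..n1 * n2}" and n2: "1 \<le> n2"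
    and sum1: "(\<Sum>s\<in>{1..n2}. block n2 x m s) = 1"
    and dist: "blk n2 a \<noteq> blk n2 b" "blk n2 a \<noteq> blk n2 c" "blk n2 b \<noteq> blk n2 c"
  shows "(\<Sum>s\<in>{1..n2}. block n2 x m s * (r s a * r s b * r s c)) = x a * x b * x c"
proof -
  have out: "r s l = x l" if "blk n2 l \<noteq> m" for s l
    using that by (simp add: r_def set_unit_block_def)
  have ins: "(\<Sum>s\<in>{1..n2}. block n2 x m s * r s l) = x l"
    if "l \<in> {1..n1 * n2}" "blk n2 l = m" for l
    unfolding r_def using that n2 by (intro sum_block_set_unit_block)
  consider "blk n2 a = m" | "blk n2 b = m" | "blk n2 c = m"
    | "blk n2 a \<noteq> m" "blk n2 b \<noteq> m" "blk n2 c \<noteq> m" by blast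
  then show ?thesis
  proof cases
    case 1
    then have "(\<Sum>s\<in>{1..n2}. block n2 x m s * (r s a * r s b * r s c)) =
      (\<Sum>s\<in>{1..n2}. block n2 x m s * r s a) * (x b * x c)"
      unfolding sum_distrib_right using dist out by (intro sum.cong) auto
    then show ?thesis
      using ins[OF range(1) 1] by simp
  next
    case 2
    then have "(\<Sum>s\<in>{1..n2}. block n2 x m s * (r s a * r s b * r s c)) =
      (\<Sum>s\<in>{1..n2}. block n2 x m s * r s b) * (x a * x c)"
      unfolding sum_distrib_right using dist out by (intro sum.cong) auto
    then show ?thesis
      using ins[OF range(2) 2] by simp
  next
    case 3
    then have "(\<Sum>s\<in>{1..n2}. block n2 x m s * (r s a * r s b * r s c)) =
      (\<Sum>s\<in>{1..n2}. block n2 x m s * r s c) * (x a * x b)"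
      unfolding sum_distrib_right using dist out by (intro sum.cong) auto
    then show ?thesis
      using ins[OF range(3) 3] by simp
  next
    \<comment> \<open>No factor depends on \<open>s\<close> here, so the total weight 1 gives the
      claim.\<close>
    case 4
    then have "(\<Sum>s\<in>{1..n2}. block n2 x m s * (r s a * r s b * r s c)) =
      (\<Sum>s\<in>{1..n2}. block n2 x m s) * (x a * x b * x c)"
      unfolding sum_distrib_right using out by (intro sum.cong) auto
    then show ?thesis
      using sum1 by simp
  qed
qed

text \<open>This isolates the property of the tensor that excludes products of two variables from
  one block.\<close>

definition block_distinct :: "nat \<Rightarrow> nat \<Rightarrow> (nat \<Rightarrow> nat \<Rightarrow> nat \<Rightarrow> real) \<Rightarrow> bool" where
  "block_distinct n1 n2 A \<longleftrightarrow>
    (\<forall>l\<in>{1..n1 * n2}. \<forall>j\<in>{1..n1 * n2}. \<forall>k\<in>{1..n1 * n2}. A l j k \<noteq> 0 \<longrightarrow>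
       blk n2 l \<noteq> blk n2 j \<and> blk n2 l \<noteq> blk n2 k \<and> blk n2 j \<noteq> blk n2 k)"

text \<open>Affinity appears as an averaging identity: the weights are the entries of block
  \<open>m\<close>, and by linearity it is enough to average each monomial with nonzero
  coefficient.\<close>

lemma cubic_form_block_affine:
  assumes A: "block_distinct n1 n2 A" and n2: "1 \<le> n2"
    and sum1: "(\<Sum>s\<in>{1..n2}. block n2 x m s) = 1"
  shows "(\<Sum>s\<in>{1..n2}. block n2 x m s * cubic_form (n1 * n2) A (set_unit_block n1 n2 m s x)) =
    cubic_form (n1 * n2) A x"
proof -
  let ?N = "{1..n1 * n2}" and ?r = "\<lambda>s. set_unit_block n1 n2 m s x"
  have "(\<Sum>s\<in>{1..n2}. block n2 x m s * cubic_form (n1 * n2) A (?r s)) =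
    (\<Sum>s\<in>{1..n2}. \<Sum>l\<in>?N. \<Sum>j\<in>?N. \<Sum>k\<in>?N.
       A l j k * (block n2 x m s * (?r s l * ?r s j * ?r s k)))"
    by (simp add: cubic_form_def sum_distrib_left mult_ac)
  \<comment> \<open>Three interchanges move the sum over \<open>s\<close> to the innermost place,
    where a single monomial can be averaged.\<close>
  also have "\<dots> = (\<Sum>l\<in>?N. \<Sum>s\<in>{1..n2}. \<Sum>j\<in>?N. \<Sum>k\<in>?N.
       A l j k * (block n2 x m s * (?r s l * ?r s j * ?r s k)))"
    by (rule sum.swap)
  also have "\<dots> = (\<Sum>l\<in>?N. \<Sum>j\<in>?N. \<Sum>s\<in>{1..n2}. \<Sum>k\<in>?N.
       A l j k * (block n2 x m s * (?r s l * ?r s j * ?r s k)))"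
    by (intro sum.cong refl sum.swap)
  also have "\<dots> = (\<Sum>l\<in>?N. \<Sum>j\<in>?N. \<Sum>k\<in>?N. \<Sum>s\<in>{1..n2}.
       A l j k * (block n2 x m s * (?r s l * ?r s j * ?r s k)))"
    by (intro sum.cong refl sum.swap)
  also have "\<dots> = (\<Sum>l\<in>?N. \<Sum>j\<in>?N. \<Sum>k\<in>?N. A l j k * x l * x j * x k)"
  proof (intro sum.cong refl)
    fix l j k assume ljk: "l \<in> ?N" "j \<in> ?N" "k \<in> ?N"
    show "(\<Sum>s\<in>{1..n2}. A l j k * (block n2 x m s * (?r s l * ?r s j * ?r s k))) =
      A l j k * x l * x j * x k"
    proof (cases "A l j k = 0")
      case False
      then have "blk n2 l \<noteq> blk n2 j" "blk n2 l \<noteq> blk n2 k" "blk n2 j \<noteq> blk n2 k"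
        using A ljk unfolding block_distinct_def by blast+
      from sum_monomial_set_unit_block[OF ljk n2 sum1 this] show ?thesis
        by (simp flip: sum_distrib_left)
    qed simp
  qed
  finally show ?thesis
    by (simp add: cubic_form_def)
qed

section \<open>Rounding the blocks one after another\<close>

lemma convex_combination_le_some:
  fixes w f :: "'a \<Rightarrow> real"
  assumes "\<And>s. s \<in> S \<Longrightarrow> w s \<ge> 0" "(\<Sum>s\<in>S. w s) = 1"
  shows "\<exists>s\<in>S. (\<Sum>t\<in>S. w t * f t) \<le> f s"
proof (rule ccontr)
  let ?c = "\<Sum>t\<in>S. w t * f t"
  assume "\<not> ?thesis"
  \<comment> \<open>If every value lay strictly below the mean \<open>?c\<close>, averaging would
    yield \<open>?c < ?c\<close>.\<close>
  then have less: "f s < ?c" if "s \<in> S" for s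
    using that by force
  \<comment> \<open>A sum over an infinite set is 0 by convention, which differs from 1.\<close>
  have fin: "finite S"
    using assms(2) by (metis sum.infinite zero_neq_one)
  \<comment> \<open>An index of nonzero weight makes the averaged inequality strict.\<close>
  obtain t where t: "t \<in> S" "w t \<noteq> 0"
    using assms(2) by (metis sum.neutral zero_neq_one)
  have "?c < (\<Sum>s\<in>S. w s * ?c)"
  proof (rule sum_strict_mono_ex1[OF fin])
    show "\<forall>s\<in>S. w s * f s \<le> w s * ?c"
      using less assms(1) by (simp add: less_imp_le mult_left_mono)
    show "\<exists>s\<in>S. w s * f s < w s * ?c"
      using t less[OF t(1)] assms(1)[OF t(1)] by (intro bexI[of _ t]) auto
  qed
  also have "\<dots> = ?c"
    using assms(2) by (simp flip: sum_distrib_right)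
  finally show False by simp
qed

text \<open>Induction on the number \<open>M\<close> of leading blocks already rounded: rounding
  block \<open>Suc M\<close> leaves the earlier ones intact.\<close>

lemma round_to_unit_blocks:
  assumes A: "block_distinct n1 n2 A" and n2: "1 \<le> n2" and x: "x \<in> feasible_R n1 n2"
    and "M \<le> n1"
  shows "\<exists>y \<in> feasible_R n1 n2. cubic_form (n1 * n2) A x \<le> cubic_form (n1 * n2) A y \<and>
    (\<forall>i\<in>{1..M}. unit_block n2 y i)"
  using \<open>M \<le> n1\<close>
proof (induction M)
  case 0
  then show ?case
    using x by auto
next
  case (Suc M)
  then obtain y where y: "y \<in> feasible_R n1 n2"
      "cubic_form (n1 * n2) A x \<le> cubic_form (n1 * n2) A y" "\<forall>i\<in>{1..M}. unit_block n2 y i"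
    by auto
  let ?m = "Suc M"
  have m: "?m \<in> {1..n1}"
    using Suc.prems by simp
  have sum1: "(\<Sum>s\<in>{1..n2}. block n2 y ?m s) = 1"
    using y(1) m unfolding feasible_R_def by blast
  have nonneg: "block n2 y ?m s \<ge> 0" if "s \<in> {1..n2}" for s
    using y(1) idx_in_range[OF m that] unfolding feasible_R_def block_def by blast
  \<comment> \<open>The form at \<open>y\<close> is the weighted mean of its values at the
    candidates, so some candidate \<open>s\<close> is at least as good.\<close>
  obtain s where s: "s \<in> {1..n2}"
    "cubic_form (n1 * n2) A y \<le> cubic_form (n1 * n2) A (set_unit_block n1 n2 ?m s y)"
    using convex_combination_le_some[of "{1..n2}" "block n2 y ?m"
        "\<lambda>s. cubic_form (n1 * n2) A (set_unit_block n1 n2 ?m s y)", OF nonneg sum1]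
    unfolding cubic_form_block_affine[OF A n2 sum1] by blast
  show ?case
  proof (intro bexI conjI ballI)
    show "set_unit_block n1 n2 ?m s y \<in> feasible_R n1 n2"
      using set_unit_block_feasible y(1) s(1) .
    show "cubic_form (n1 * n2) A x \<le> cubic_form (n1 * n2) A (set_unit_block n1 n2 ?m s y)"
      using y(2) s(2) by simp
    fix i assume "i \<in> {1..?m}"
    then show "unit_block n2 (set_unit_block n1 n2 ?m s y) i"
      using y(3) s(1) Suc.prems
      by (intro unit_block_set_unit_block) (auto simp: le_Suc_eq)
  qed
qed

section \<open>Support and number of the points made of unit vectors\<close>

lemma norm0_unit_blocks:
  assumes n2: "1 \<le> n2" and u: "\<forall>i\<in>{1..n1}. unit_block n2 x i"
  shows "norm0 (n1 * n2) x = n1"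
proof -
  \<comment> \<open>\<open>\<sigma> i\<close> is the position of the 1 in block \<open>i\<close>;
    the support then consists of one coordinate per block.\<close>
  obtain \<sigma> where \<sigma>: "\<And>i. i \<in> {1..n1} \<Longrightarrow> \<sigma> i \<in> {1..n2}"
    "\<And>i j. i \<in> {1..n1} \<Longrightarrow> j \<in> {1..n2} \<Longrightarrow> x (idx n2 i j) = (if j = \<sigma> i then 1 else 0)"
    using u unfolding unit_block_def block_def by metis
  have "{l \<in> {1..n1 * n2}. x l \<noteq> 0} = (\<lambda>i. idx n2 i (\<sigma> i)) ` {1..n1}" (is "?L = ?R")
  proof (intro equalityI subsetI)
    fix l assume l: "l \<in> ?L"
    then have b: "blk n2 l \<in> {1..n1}" and l1: "idx n2 (blk n2 l) (pos n2 l) = l"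
      using blk_in_range idx_blk_pos by auto
    have "x l = (if pos n2 l = \<sigma> (blk n2 l) then 1 else 0)"
      using \<sigma>(2)[OF b pos_in_range[OF n2, of l]] unfolding l1 .
    then have "pos n2 l = \<sigma> (blk n2 l)"
      using l by (metis (mono_tags, lifting) mem_Collect_eq)
    then show "l \<in> ?R"
      using b l1 by (intro image_eqI[of _ _ "blk n2 l"]) simp_all
  next
    fix l assume "l \<in> ?R"
    then show "l \<in> ?L"
      using \<sigma> idx_in_range by fastforce
  qed
  \<comment> \<open>\<open>blk n2\<close> recovers \<open>i\<close>, so different blocks give
    different support coordinates.\<close>
  moreover have "inj_on (\<lambda>i. idx n2 i (\<sigma> i)) {1..n1}"
    using \<sigma>(1) blk_idx by (intro inj_on_inverseI[of _ "blk n2"]) auto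
  ultimately show ?thesis
    by (simp add: norm0_def card_image)
qed

text \<open>Such points take only the values 0 and 1 on the index set and are
  \<open>undefined\<close> off it, so they lie in a finite function space.\<close>

lemma finite_unit_blocks:
  assumes "1 \<le> n2"
  shows "finite {x \<in> feasible_R n1 n2. \<forall>i\<in>{1..n1}. unit_block n2 x i}"
proof (rule finite_subset)
  show "{x \<in> feasible_R n1 n2. \<forall>i\<in>{1..n1}. unit_block n2 x i} \<subseteq> {1..n1 * n2} \<rightarrow>\<^sub>E {0, 1}"
  proof (intro subsetI PiE_I)
    fix x l
    assume "x \<in> {x \<in> feasible_R n1 n2. \<forall>i\<in>{1..n1}. unit_block n2 x i}"
      and l: "l \<in> {1..n1 * n2}"
    then have "unit_block n2 x (blk n2 l)"
      using blk_in_range[OF l] by blast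
    then have "block n2 x (blk n2 l) (pos n2 l) \<in> {0, 1}"
      using pos_in_range[OF assms, of l] unfolding unit_block_def by auto
    then show "x l \<in> {0, 1}"
      using idx_blk_pos[of l n2] l by (simp add: block_def)
  next
    fix x l
    assume "x \<in> {x \<in> feasible_R n1 n2. \<forall>i\<in>{1..n1}. unit_block n2 x i}"
      and "l \<notin> {1..n1 * n2}"
    then show "x l = undefined"
      unfolding feasible_R_def rvecs_def by blast
  qed
qed (simp add: finite_PiE)

section \<open>Application to the matching problem\<close>

lemma feasible_R_nonempty:
  assumes "1 \<le> n2"
  shows "feasible_R n1 n2 \<noteq> {}"
proof -
  \<comment> \<open>The first unit vector is placed in every block.\<close>
  let ?x = "\<lambda>l\<in>{1..n1 * n2}. if pos n2 l = 1 then 1 else (0::real)"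
  have "(\<Sum>j\<in>{1..n2}. block n2 ?x i j) = 1" if i: "i \<in> {1..n1}" for i
  proof -
    have "(\<Sum>j\<in>{1..n2}. block n2 ?x i j) = (\<Sum>j\<in>{1..n2}. if j = 1 then 1 else 0)"
      using i idx_in_range[OF i] pos_idx[of i] by (intro sum.cong) (auto simp: block_def)
    then show ?thesis
      using assms by simp
  qed
  then have "?x \<in> feasible_R n1 n2"
    by (simp add: feasible_R_def rvecs_def)
  then show ?thesis by blast
qed

text \<open>A nonzero entry makes the three block numbers a hyperedge of \<open>E1\<close>, and
  having cardinality 3 they are pairwise distinct.\<close>

lemma score_tensor_block_distinct:
  assumes "uniform3 {1..n1} E1" "score_tensor n1 n2 E1 E2 B" "1 \<le> n2"
  shows "block_distinct n1 n2 (flat_tensor n2 B)"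
  unfolding block_distinct_def
proof (intro ballI impI)
  fix l j k
  assume ljk: "l \<in> {1..n1 * n2}" "j \<in> {1..n1 * n2}" "k \<in> {1..n1 * n2}"
    and "flat_tensor n2 B l j k \<noteq> 0"
  moreover note ljk[THEN blk_in_range] pos_in_range[OF assms(3)]
  ultimately have "{blk n2 l, blk n2 j, blk n2 k} \<in> E1"
    using assms(2) unfolding score_tensor_def flat_tensor_def by blast
  then have "card {blk n2 l, blk n2 j, blk n2 k} = 3"
    using assms(1) unfolding uniform3_def by blast
  then show "blk n2 l \<noteq> blk n2 j \<and> blk n2 l \<noteq> blk n2 k \<and> blk n2 j \<noteq> blk n2 k"
    by (auto simp: card_insert_if split: if_splits)
qed

theorem theorem1:
  fixes n1 n2 :: nat
    and E1 E2 :: "nat set set"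
    and B :: "nat \<Rightarrow> nat \<Rightarrow> nat \<Rightarrow> nat \<Rightarrow> nat \<Rightarrow> nat \<Rightarrow> real"
  assumes "1 \<le> n1" and "n1 \<le> n2"
    and "uniform3 {1..n1} E1" and "uniform3 {1..n2} E2"
    and "score_tensor n1 n2 E1 E2 B"
  shows "\<exists>x. is_arg_min (objective n1 n2 B) (\<lambda>y. y \<in> feasible_R n1 n2) x \<and>
             norm0 (n1 * n2) x = n1 \<and>
             is_arg_min (objective n1 n2 B) (\<lambda>y. y \<in> feasible_P n1 n2) x"
proof -
  have n2: "1 \<le> n2"
    using assms by simp
  let ?f = "objective n1 n2 B"
  let ?U = "{x \<in> feasible_R n1 n2. \<forall>i\<in>{1..n1}. unit_block n2 x i}"
  \<comment> \<open>The factor -1/6 turns an increase of the cubic form into a decrease of the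
    objective.\<close>
  have round: "\<exists>y\<in>?U. ?f y \<le> ?f x" if "x \<in> feasible_R n1 n2" for x
    using round_to_unit_blocks[OF score_tensor_block_distinct[OF assms(3,5) n2] n2 that order.refl]
    by (auto simp: objective_def)
  then have "?U \<noteq> {}"
    using feasible_R_nonempty[OF n2, of n1] by blast
  then obtain x where x: "x \<in> ?U" "\<And>y. y \<in> ?U \<Longrightarrow> ?f x \<le> ?f y"
    using ex_is_arg_min_if_finite[OF finite_unit_blocks[OF n2, of n1], of ?f]
    by (auto simp: is_arg_min_linorder)
  have norm: "norm0 (n1 * n2) x = n1"
    using x(1) norm0_unit_blocks[OF n2] by blast
  \<comment> \<open>Any feasible point is dominated by some point of \<open>?U\<close>, and
    \<open>x\<close> is best within \<open>?U\<close>.\<close>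
  have min: "?f x \<le> ?f y" if "y \<in> feasible_R n1 n2" for y
    using round[OF that] x(2) by (meson order.trans)
  show ?thesis
  proof (intro exI conjI)
    show "is_arg_min ?f (\<lambda>y. y \<in> feasible_R n1 n2) x"
      using x(1) min by (simp add: is_arg_min_linorder)
    \<comment> \<open>The sparse problem minimizes over a subset of \<open>feasible_R n1 n2\<close>
      that still contains \<open>x\<close>.\<close>
    have "feasible_P n1 n2 = {y \<in> feasible_R n1 n2. norm0 (n1 * n2) y \<le> n1}"
      by (auto simp: feasible_P_def feasible_R_def)
    then show "is_arg_min ?f (\<lambda>y. y \<in> feasible_P n1 n2) x"
      using x(1) min norm by (simp add: is_arg_min_linorder)
  qed (fact norm)
qed

end
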